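(* Let $\mathbb{A}_1,\mathbb{A}_2\in\mathbb{R}^{n\times n}$, let $\mathcal{P}$ be a parameter set, let $\theta_1,\theta_2:\mathcal{P}\to\mathbb{R}$ be functions, and set $\mathbb{A}(\mu)=\theta_1(\mu)\mathbb{A}_1+\theta_2(\mu)\mathbb{A}_2$ for $\mu\in\mathcal{P}$. Let $\mu_0,\mu_1,\mu_2\in\mathcal{P}$, where $\mathbb{A}(\mu_0)$ is invertible, and let $\mathbb{B}=\mathbb{A}(\mu_0)^{-1}$. Assume that for each $i\in\{1,2\}$ the vectors $(\theta_1(\mu_i),\theta_2(\mu_i))$ and $(\theta_1(\mu_0),\theta_2(\mu_0))$ in $\mathbb{R}^2$ are linearly independent. Then for every integer $m>0$ and every $\mathbf{v}\in\mathbb{R}^n$, \[ \mathcal{K}_m(\mathbb{B}\mathbb{A}(\mu_1),\mathbf{v})=\mathcal{K}_m(\mathbb{B}\mathbb{A}(\mu_2),\mathbf{v}), \qquad \mathcal{K}_m(\mathbb{B}^t\mathbb{A}(\mu_1)^t,\mathbf{v})=\mathcal{K}_m(\mathbb{B}^t\mathbb{A}(\mu_2)^t,\mathbf{v}). \]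
   Context: For $\mathbb{C}\in\mathbb{R}^{n\times n}$, $\mathbf{v}\in\mathbb{R}^n$ and an integer $m>0$, the Krylov subspace is $\mathcal{K}_m(\mathbb{C},\mathbf{v}):=\mathrm{Span}\{\mathbf{v},\mathbb{C}\mathbf{v},\ldots,\mathbb{C}^{m-1}\mathbf{v}\}$. The superscript $t$ denotes the matrix transpose. *)

theory Defs
  imports "HOL-Analysis.Analysis"
begin

(* The library operator ^ on real^'n^'n is the entrywise power, since times on vec is
   componentwise; the matrix power has to be built from the matrix product **. *)
primrec matrix_pow :: "real^'n^'n \<Rightarrow> nat \<Rightarrow> real^'n^'n" where
  "matrix_pow C 0 = mat 1"
| "matrix_pow C (Suc k) = C ** matrix_pow C k"

definition krylov :: "nat \<Rightarrow> real^'n^'n \<Rightarrow> real^'n \<Rightarrow> (real^'n) set" where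
  "krylov m C v = span ((\<lambda>k. matrix_pow C k *v v) ` {..<m})"

(* Linear independence of the two-element family (u, w). The library notion concerns sets,
   and {u, u} = {u} would be independent for nonzero u, so distinctness is required as well. *)
definition independent_pair :: "'a::real_vector \<Rightarrow> 'a \<Rightarrow> bool" where
  "independent_pair u w \<longleftrightarrow> u \<noteq> w \<and> independent {u, w}"

end

(* The pair (\<theta>1 \<mu>0, \<theta>2 \<mu>0), (\<theta>1 \<mu>1, \<theta>2 \<mu>1) is a basis of the plane, so A \<mu>2 = a A \<mu>0 + b A \<mu>1 and
   therefore B A \<mu>2 = a I + b B A \<mu>1. A matrix a I + b C has Krylov spaces contained in those of C,
   and exchanging \<mu>1 and \<mu>2 gives the reverse inclusion. *)

theory Submission
  imports Defs
begin

lemma krylov_mono: "m \<le> n \<Longrightarrow> krylov m C v \<subseteq> krylov n C v"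
  unfolding krylov_def by (intro span_mono image_mono) auto

text \<open>By linearity it suffices to look at the generators, and \<open>C\<close> sends the one
  with exponent k to the one with exponent k + 1; hence the index grows by one.\<close>

lemma matrix_vector_mult_krylov:
  assumes "x \<in> krylov m C v"
  shows "C *v x \<in> krylov (Suc m) C v"
proof -
  let ?S = "(\<lambda>k. matrix_pow C k *v v) ` {..<m}"
  have "C *v x \<in> span ((*v) C ` ?S)"
    using assms linear_span_image[OF matrix_vector_mul_linear[of C], of ?S]
    unfolding krylov_def by blast
  moreover have "(*v) C ` ?S \<subseteq> (\<lambda>k. matrix_pow C k *v v) ` {..<Suc m}"
  proof safe
    fix k assume "k < m"
    then show "C *v (matrix_pow C k *v v) \<in> (\<lambda>k. matrix_pow C k *v v) ` {..<Suc m}"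
      by (intro image_eqI[where x = "Suc k"]) (simp_all add: matrix_vector_mul_assoc)
  qed
  ultimately show ?thesis
    unfolding krylov_def using span_mono by blast
qed

text \<open>The k-th power of \<open>D\<close> is a polynomial in \<open>C\<close> of degree at most
  k. The index is \<open>Suc k\<close> because \<open>krylov k\<close> stops at exponent k -
  1.\<close>

lemma matrix_pow_shift_in_krylov:
  assumes "D = a *\<^sub>R mat 1 + b *\<^sub>R C"
  shows "matrix_pow D k *v v \<in> krylov (Suc k) C v"
proof (induction k)
  case 0
  show ?case by (simp add: krylov_def span_base)
next
  case (Suc k)
  let ?u = "matrix_pow D k *v v"
  have "matrix_pow D (Suc k) *v v = D *v ?u"
    by (simp add: matrix_vector_mul_assoc)
  also have "\<dots> = a *\<^sub>R ?u + b *\<^sub>R (C *v ?u)"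
    by (simp add: assms matrix_vector_mult_add_rdistrib flip: scaleR_matrix_vector_assoc)
  also have "\<dots> \<in> krylov (Suc (Suc k)) C v"
    using Suc matrix_vector_mult_krylov[OF Suc] krylov_mono[of "Suc k" "Suc (Suc k)" C v]
    unfolding krylov_def by (intro span_add span_scale) auto
  finally show ?case .
qed

text \<open>Only an inclusion: for b = 0 the left side collapses to the span of
  \<open>v\<close>.\<close>

lemma krylov_shift_subset:
  assumes "D = a *\<^sub>R mat 1 + b *\<^sub>R C"
  shows "krylov m D v \<subseteq> krylov m C v"
proof -
  have "matrix_pow D k *v v \<in> krylov m C v" if "k < m" for k
    using matrix_pow_shift_in_krylov[OF assms, of k v] krylov_mono[of "Suc k" m C v] that by auto
  then have "(\<lambda>k. matrix_pow D k *v v) ` {..<m} \<subseteq> krylov m C v"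
    by auto
  then show ?thesis
    unfolding krylov_def[of m D] by (rule span_minimal) (simp add: krylov_def)
qed

lemma independent_pair_real2_combination:
  fixes u w z :: "real^2"
  assumes "independent_pair u w"
  obtains a b where "z = a *\<^sub>R u + b *\<^sub>R w"
proof -
  \<comment> \<open>The distinctness in \<open>independent_pair\<close> makes the cardinality 2, so
    that independence forces the pair to span the plane.\<close>
  have "independent {u, w}" and "card {u, w} = DIM(real^2)"
    using assms by (auto simp: independent_pair_def)
  then have "UNIV \<subseteq> span {u, w}"
    by (intro card_ge_dim_independent) auto
  then have "z \<in> span {u, w}" by blast
  then obtain a b where "z - a *\<^sub>R u = b *\<^sub>R w"
    by (auto simp: span_insert span_singleton)
  then have "z = a *\<^sub>R u + b *\<^sub>R w" by (simp add: algebra_simps)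
  then show thesis by (rule that)
qed

text \<open>The combination is found among the coefficient vectors in the plane and then carried
  over to the matrices, so \<open>A1\<close> and \<open>A2\<close> may be linearly dependent. One
  expression of \<open>D\<close> through \<open>A0\<close> and \<open>C\<close> serves both
  inclusions.\<close>

lemma krylov_affine_subset:
  fixes A0 A1 A2 C D B :: "real^'n^'n"
  assumes A0: "A0 = r *\<^sub>R A1 + s *\<^sub>R A2" and C: "C = p *\<^sub>R A1 + q *\<^sub>R A2"
    and D: "D = p' *\<^sub>R A1 + q' *\<^sub>R A2"
    and left: "B ** A0 = mat 1" and right: "A0 ** B = mat 1"
    and indep: "independent_pair (vector [p, q] :: real^2) (vector [r, s])"
  shows "krylov m (B ** D) v \<subseteq> krylov m (B ** C) v"
    and "krylov m (transpose B ** transpose D) v \<subseteq> krylov m (transpose B ** transpose C) v"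
proof -
  obtain b a where "(vector [p', q'] :: real^2) = b *\<^sub>R vector [p, q] + a *\<^sub>R vector [r, s]"
    using independent_pair_real2_combination[OF indep] by blast
  then have "p' = a * r + b * p" "q' = a * s + b * q"
    by (auto simp: vec_eq_iff forall_2)
  then have D_eq: "D = a *\<^sub>R A0 + b *\<^sub>R C"
    by (simp add: A0 C D algebra_simps)
  have "B ** D = a *\<^sub>R mat 1 + b *\<^sub>R (B ** C)"
    by (simp add: D_eq matrix_add_ldistrib matrix_scalar_ac left flip: scalar_matrix_assoc)
  then show "krylov m (B ** D) v \<subseteq> krylov m (B ** C) v"
    by (rule krylov_shift_subset)
  have "transpose D = a *\<^sub>R transpose A0 + b *\<^sub>R transpose C"
    by (simp add: D_eq transpose_def vec_eq_iff)
  \<comment> \<open>Transposition reverses products, so here \<open>B\<close> has to be a right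
    inverse of \<open>A0\<close>; the untransposed case used the left inverse.\<close>
  moreover have "transpose B ** transpose A0 = mat 1"
    by (simp add: right transpose_mat flip: matrix_transpose_mul)
  ultimately have "transpose B ** transpose D = a *\<^sub>R mat 1 + b *\<^sub>R (transpose B ** transpose C)"
    by (simp add: matrix_add_ldistrib matrix_scalar_ac flip: scalar_matrix_assoc)
  then show "krylov m (transpose B ** transpose D) v \<subseteq> krylov m (transpose B ** transpose C) v"
    by (rule krylov_shift_subset)
qed

theorem lemma2p2:
  fixes A1 A2 B :: "real^'n^'n"
    and P :: "'p set"
    and \<theta>1 \<theta>2 :: "'p \<Rightarrow> real"
    and A :: "'p \<Rightarrow> real^'n^'n"
    and \<mu>0 \<mu>1 \<mu>2 :: 'p
  assumes A: "\<And>\<mu>. \<mu> \<in> P \<Longrightarrow> A \<mu> = \<theta>1 \<mu> *\<^sub>R A1 + \<theta>2 \<mu> *\<^sub>R A2"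
    and mu: "\<mu>0 \<in> P" "\<mu>1 \<in> P" "\<mu>2 \<in> P"
    and inv: "invertible (A \<mu>0)"
    and B: "B = matrix_inv (A \<mu>0)"
    and indep1: "independent_pair (vector [\<theta>1 \<mu>1, \<theta>2 \<mu>1] :: real^2) (vector [\<theta>1 \<mu>0, \<theta>2 \<mu>0])"
    and indep2: "independent_pair (vector [\<theta>1 \<mu>2, \<theta>2 \<mu>2] :: real^2) (vector [\<theta>1 \<mu>0, \<theta>2 \<mu>0])"
  shows "\<forall>m>0. \<forall>v :: real^'n.
           krylov m (B ** A \<mu>1) v = krylov m (B ** A \<mu>2) v \<and>
           krylov m (transpose B ** transpose (A \<mu>1)) v = krylov m (transpose B ** transpose (A \<mu>2)) v"
proof (intro allI impI)
  fix m :: nat and v :: "real^'n"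
  \<comment> \<open>\<open>matrix_inv\<close> is a choice of a two-sided inverse, and invertibility
    says that one exists.\<close>
  have "B ** A \<mu>0 = mat 1" "A \<mu>0 ** B = mat 1"
    using someI_ex[OF inv[unfolded invertible_def]] by (simp_all add: B matrix_inv_def)
  note subset = krylov_affine_subset[OF A[OF mu(1)] _ _ this]
  show "krylov m (B ** A \<mu>1) v = krylov m (B ** A \<mu>2) v \<and>
      krylov m (transpose B ** transpose (A \<mu>1)) v = krylov m (transpose B ** transpose (A \<mu>2)) v"
    \<comment> \<open>The first instance puts the spaces of \<mu>2 inside those of \<mu>1, the
      second the reverse; each uses the independence of the parameter on the larger side.\<close>
    using subset[OF A[OF mu(2)] A[OF mu(3)] indep1] subset[OF A[OF mu(3)] A[OF mu(2)] indep2]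
    by (intro conjI subset_antisym)
qed

end
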